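(* Let $f\in C^1([0,T]\times\overline{\Omega}\times[-1,1])$ solve the linear transport equation under diffusive scaling $$\varepsilon\,\partial_t f + v\,\partial_x f = \frac{1}{\varepsilon}\mathcal L(f)\quad\text{on }[0,T]\times\Omega\times[-1,1],\qquad \mathcal L(f)(t,x,v)=\sigma(x)\Big[\tfrac12\int_{-1}^1 f(t,x,v')\,dv' - f(t,x,v)\Big],$$ with initial condition $f(0,x,v)=f_0(x,v)$ and inflow boundary condition $f(t,x,v)=g(t,x,v)$ for $t\in[0,T]$, $(x,v)\in\gamma_-$. Let $\{(m_{[j]},w_{[j]},b_{[j]})\}_{j=1}^\infty$ be a sequence of neural network parameters such that the neural network functions $f_j(t,x,v)=f^{nn}(t,x,v;m_{[j]},w_{[j]},b_{[j]})$ satisfy $Loss_{Total}(f_j)\to 0$ as $j\to\infty$. Then $$\|f_j-f\|_{L^\infty([0,T];\,L^2(\Omega\times[-1,1]))}\to 0\qquad\text{as } j\to\infty.$$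
   Context: Setting. $T>0$ and $\varepsilon>0$ are fixed real numbers; $\Omega\subset\mathbb R$ is a bounded open interval, $\partial\Omega$ is its set of two endpoints, and $n_x\in\{-1,1\}$ is the outward unit normal at $x\in\partial\Omega$; the velocity variable is $v\in[-1,1]$; $\sigma:\Omega\to\mathbb R$ is a bounded measurable scattering coefficient; $f_0$ and $g$ are given initial and inflow boundary data. The incoming phase boundary is $\gamma_-=\{(x,v)\in\partial\Omega\times[-1,1]: n_x v<0\}$. $C^1([0,T]\times\overline\Omega\times[-1,1])$ means that $f$ and its first partial derivatives are continuous up to the boundary. Neural networks. Fix a number of layers $L\ge 2$ and a $C^1$ activation function $\bar\sigma:\mathbb R\to\mathbb R$ (for example $\tanh$). For widths $m=(m_0,m_1,\dots,m_{L-1})$ with $m_0=3$, weights $w=\{w^{(k)}_{ji}\}$ and biases $b=\{b^{(k)}_j\}$, $k=1,\dots,L$ (with $w^{(k)}\in\mathbb R^{m_k\times m_{k-1}}$, $b^{(k)}\in\mathbb R^{m_k}$, and $m_L=1$), the network function $f^{nn}(t,x,v;m,w,b)$ is $u^{(L)}_1$, where $u^{(1)}=w^{(1)}(t,x,v)^{\top}+b^{(1)}$ and $u^{(l+1)}_j=\sum_{i=1}^{m_l}w^{(l+1)}_{ji}\,\bar\sigma(u^{(l)}_i)+b^{(l+1)}_j$ for $l=1,\dots,L-1$. Loss functions. For a $C^1$ function $h$ on $[0,T]\times\overline\Omega\times[-1,1]$, $$Loss_{GE}(h)=\int_0^T\!\int_\Omega\int_{-1}^1\Big|\varepsilon\partial_t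 h+v\,\partial_x h-\tfrac1\varepsilon\mathcal L(h)\Big|^2dv\,dx\,dt,$$ $$Loss_{IC}(h)=\int_\Omega\int_{-1}^1|h(0,x,v)-f_0(x,v)|^2\,dv\,dx,$$ $$Loss_{BC}(h)=\sum_{x\in\partial\Omega}\int_0^T\!\int_{\{v\in[-1,1]:\,n_x v<0\}}|h(t,x,v)-g(t,x,v)|^2\,dv\,dt,$$ and $Loss_{Total}(h)=\lambda_g Loss_{GE}(h)+\lambda_i Loss_{IC}(h)+\lambda_b Loss_{BC}(h)$ with fixed weights $\lambda_g,\lambda_i,\lambda_b>0$. *)

theory Defs
  imports "HOL-Analysis.Analysis" "HOL-Probability.Essential_Supremum"
begin

text \<open>
  Throughout, \<open>\<Omega> = {a<..<b}\<close>, and a function of time, position and velocity is a function on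
  triples \<open>(t, x, v)\<close>; only its values on \<open>{0..T} \<times> {a..b} \<times> {-1..1}\<close> matter. The partial
  derivatives are taken within these closed intervals, hence are one-sided at the end points.
\<close>

definition partial_t :: "real \<Rightarrow> (real \<times> real \<times> real \<Rightarrow> real) \<Rightarrow> real \<times> real \<times> real \<Rightarrow> real" where
  "partial_t T h = (\<lambda>(t, x, v). vector_derivative (\<lambda>s. h (s, x, v)) (at t within {0..T}))"

definition partial_x :: "real \<Rightarrow> real \<Rightarrow> (real \<times> real \<times> real \<Rightarrow> real) \<Rightarrow> real \<times> real \<times> real \<Rightarrow> real" where
  "partial_x a b h = (\<lambda>(t, x, v). vector_derivative (\<lambda>y. h (t, y, v)) (at x within {a..b}))"

definition partial_v :: "(real \<times> real \<times> real \<Rightarrow> real) \<Rightarrow> real \<times> real \<times> real \<Rightarrow> real" where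
  "partial_v h = (\<lambda>(t, x, v). vector_derivative (\<lambda>u. h (t, x, u)) (at v within {-1..1}))"

definition C1_up_to_boundary :: "real \<Rightarrow> real \<Rightarrow> real \<Rightarrow> (real \<times> real \<times> real \<Rightarrow> real) \<Rightarrow> bool" where
  "C1_up_to_boundary T a b h \<longleftrightarrow>
     (let D = {0..T} \<times> {a..b} \<times> {-1..1} in
       continuous_on D h \<and>
       (\<forall>(t, x, v) \<in> D.
          (\<lambda>s. h (s, x, v)) differentiable (at t within {0..T}) \<and>
          (\<lambda>y. h (t, y, v)) differentiable (at x within {a..b}) \<and>
          (\<lambda>u. h (t, x, u)) differentiable (at v within {-1..1})) \<and>
       continuous_on D (partial_t T h) \<and>
       continuous_on D (partial_x a b h) \<and>
       continuous_on D (partial_v h))"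

definition scattering :: "(real \<Rightarrow> real) \<Rightarrow> (real \<times> real \<times> real \<Rightarrow> real) \<Rightarrow> real \<times> real \<times> real \<Rightarrow> real" where
  "scattering \<sigma> h = (\<lambda>(t, x, v).
     \<sigma> x * (1 / 2 * (LINT v':{-1..1}|lebesgue. h (t, x, v')) - h (t, x, v)))"

text \<open>The outward unit normal of \<open>\<Omega>\<close>; meaningful for \<open>x \<in> {a, b}\<close> with \<open>a < b\<close> only.\<close>

definition outward_normal :: "real \<Rightarrow> real \<Rightarrow> real \<Rightarrow> real" where
  "outward_normal a b x = (if x = b then 1 else - 1)"

definition gamma_minus :: "real \<Rightarrow> real \<Rightarrow> (real \<times> real) set" where
  "gamma_minus a b = {(x, v). x \<in> {a, b} \<and> v \<in> {-1..1} \<and> outward_normal a b x * v < 0}"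

text \<open>
  Layers, rows and columns are numbered from 1: \<open>w k j i\<close> is the entry \<open>w\<^bsup>(k)\<^esup>\<^bsub>ji\<^esub>\<close>, and
  \<open>nn_layer act m w \<beta> z l j\<close> is \<open>u\<^bsup>(l)\<^esup>\<^sub>j\<close> for \<open>l \<ge> 1\<close>, with layer \<open>0\<close> holding the input
  vector \<open>z\<close>, to which the activation is not applied. Entries outside the index ranges given
  by the widths \<open>m\<close> are never read; the width of the output layer is 1, so \<open>m L\<close> is not needed.
\<close>

primrec nn_layer :: "(real \<Rightarrow> real) \<Rightarrow> (nat \<Rightarrow> nat) \<Rightarrow> (nat \<Rightarrow> nat \<Rightarrow> nat \<Rightarrow> real) \<Rightarrow> (nat \<Rightarrow> nat \<Rightarrow> real) \<Rightarrow>
    (nat \<Rightarrow> real) \<Rightarrow> nat \<Rightarrow> nat \<Rightarrow> real" where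
  "nn_layer act m w \<beta> z 0 = z"
| "nn_layer act m w \<beta> z (Suc l) = (\<lambda>j.
     (\<Sum>i = 1..m l. w (Suc l) j i *
        (if l = 0 then nn_layer act m w \<beta> z l i else act (nn_layer act m w \<beta> z l i)))
     + \<beta> (Suc l) j)"

definition nn_input :: "real \<times> real \<times> real \<Rightarrow> nat \<Rightarrow> real" where
  "nn_input = (\<lambda>(t, x, v) i. if i = 1 then t else if i = 2 then x else v)"

definition nn_fun :: "nat \<Rightarrow> (real \<Rightarrow> real) \<Rightarrow> (nat \<Rightarrow> nat) \<Rightarrow> (nat \<Rightarrow> nat \<Rightarrow> nat \<Rightarrow> real) \<Rightarrow>
    (nat \<Rightarrow> nat \<Rightarrow> real) \<Rightarrow> real \<times> real \<times> real \<Rightarrow> real" where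
  "nn_fun L act m w \<beta> p = nn_layer act m w \<beta> (nn_input p) L 1"

definition Loss_GE :: "real \<Rightarrow> real \<Rightarrow> real \<Rightarrow> real \<Rightarrow> (real \<Rightarrow> real) \<Rightarrow>
    (real \<times> real \<times> real \<Rightarrow> real) \<Rightarrow> real" where
  "Loss_GE T a b \<epsilon> \<sigma> h =
     (LINT t:{0..T}|lebesgue. LINT x:{a<..<b}|lebesgue. LINT v:{-1..1}|lebesgue.
        \<bar>\<epsilon> * partial_t T h (t, x, v) + v * partial_x a b h (t, x, v)
          - 1 / \<epsilon> * scattering \<sigma> h (t, x, v)\<bar>\<^sup>2)"

definition Loss_IC :: "real \<Rightarrow> real \<Rightarrow> (real \<times> real \<Rightarrow> real) \<Rightarrow>
    (real \<times> real \<times> real \<Rightarrow> real) \<Rightarrow> real" where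
  "Loss_IC a b f0 h =
     (LINT x:{a<..<b}|lebesgue. LINT v:{-1..1}|lebesgue. \<bar>h (0, x, v) - f0 (x, v)\<bar>\<^sup>2)"

definition Loss_BC :: "real \<Rightarrow> real \<Rightarrow> real \<Rightarrow> (real \<times> real \<times> real \<Rightarrow> real) \<Rightarrow>
    (real \<times> real \<times> real \<Rightarrow> real) \<Rightarrow> real" where
  "Loss_BC T a b g h =
     (\<Sum>x\<in>{a, b}. LINT t:{0..T}|lebesgue.
        LINT v:{v \<in> {-1..1}. outward_normal a b x * v < 0}|lebesgue.
          \<bar>h (t, x, v) - g (t, x, v)\<bar>\<^sup>2)"

definition Loss_Total :: "real \<Rightarrow> real \<Rightarrow> real \<Rightarrow> real \<Rightarrow> real \<Rightarrow> real \<Rightarrow> real \<Rightarrow> (real \<Rightarrow> real) \<Rightarrow>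
    (real \<times> real \<Rightarrow> real) \<Rightarrow> (real \<times> real \<times> real \<Rightarrow> real) \<Rightarrow> (real \<times> real \<times> real \<Rightarrow> real) \<Rightarrow> real" where
  "Loss_Total lam_g lam_i lam_b T a b \<epsilon> \<sigma> f0 g h =
     lam_g * Loss_GE T a b \<epsilon> \<sigma> h + lam_i * Loss_IC a b f0 h + lam_b * Loss_BC T a b g h"

text \<open>
  The norms of \<open>L\<^sup>2(\<Omega> \<times> [-1,1])\<close> and \<open>L\<^sup>\<infinity>([0,T]; L\<^sup>2(\<Omega> \<times> [-1,1]))\<close>. The Bochner integral is 0 for
  non-integrable integrands, so these are norms only for functions whose square is integrable
  in \<open>(x, v)\<close>, such as those continuous on the closed domain.
\<close>

definition L2_norm_xv :: "real \<Rightarrow> real \<Rightarrow> (real \<times> real \<Rightarrow> real) \<Rightarrow> real" where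
  "L2_norm_xv a b k = sqrt (LINT p:{a<..<b} \<times> {-1..1}|lebesgue. \<bar>k p\<bar>\<^sup>2)"

definition Linf_L2_norm :: "real \<Rightarrow> real \<Rightarrow> real \<Rightarrow> (real \<times> real \<times> real \<Rightarrow> real) \<Rightarrow> ereal" where
  "Linf_L2_norm T a b h =
     esssup (lebesgue_on {0..T}) (\<lambda>t. ereal (L2_norm_xv a b (\<lambda>(x, v). h (t, x, v))))"

end

theory Submission
  imports Defs
begin

text \<open>
  The argument is an energy estimate for the error \<open>h = f\<^sub>j - f\<close>, which by linearity satisfies the
  transport equation up to the residual \<open>R\<close> of \<open>f\<^sub>j\<close>. For \<open>E(t) = \<integral>\<integral> h\<^sup>2 dv dx\<close>, the streaming
  term integrates to a boundary flux, whose only contribution of the wrong sign comes from the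
  incoming velocities, and the collision term is at most \<open>S E\<close> in absolute value, where \<open>S\<close> bounds \<open>|\<sigma>|\<close>.
  Hence
  \<open>E' \<le> K E + (\<integral>\<integral> R\<^sup>2 dv dx + inflow) / \<epsilon>\<close> with \<open>K = (1 + 2 S / \<epsilon>) / \<epsilon>\<close>, and Gronwall's
  inequality bounds \<open>E\<close> on \<open>[0,T]\<close> by a constant multiple of the total loss.
\<close>

section \<open>Preliminaries\<close>

lemma continuous_on_slice:
  assumes "continuous_on (A \<times> B) f" "x \<in> A"
  shows "continuous_on B (\<lambda>y. f (x, y))"
  by (rule continuous_on_compose2[OF assms(1)]) (use assms in \<open>auto intro!: continuous_intros\<close>)

text \<open>The weight \<open>s\<close> is merely bounded and measurable, so the product
  \<open>s x * u t x\<close> need not be jointly continuous. Continuity in \<open>t\<close> comes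
  instead from uniform continuity of \<open>u\<close> on the compact set
  \<open>U \<times> {a..b}\<close>: a small change of \<open>u\<close>, uniform in \<open>x\<close>,
  changes the integral by at most that amount times the bound of \<open>s\<close> and the length of
  the interval.\<close>

lemma continuous_on_integral_weight:
  fixes u :: "'a::metric_space \<Rightarrow> real \<Rightarrow> real"
  assumes s: "s \<in> borel_measurable (lebesgue_on {a<..<b})" "bounded (s ` {a<..<b})"
    and u: "continuous_on (U \<times> {a..b}) (\<lambda>(t, x). u t x)"
    and U: "compact U"
  shows absolutely_integrable_weight:
      "\<And>t. t \<in> U \<Longrightarrow> (\<lambda>x. s x * u t x) absolutely_integrable_on {a<..<b}"
    and "continuous_on U (\<lambda>t. integral {a<..<b} (\<lambda>x. s x * u t x))"
proof -
  show ai: "(\<lambda>x. s x * u t x) absolutely_integrable_on {a<..<b}" if "t \<in> U" for t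
  proof -
    have "continuous_on {a..b} (u t)"
      using continuous_on_slice[OF u that] by simp
    hence "u t absolutely_integrable_on {a..b}"
      by (rule absolutely_integrable_continuous_real)
    hence "u t absolutely_integrable_on {a<..<b}"
      by (rule set_integrable_subset) auto
    thus ?thesis
      by (intro absolutely_integrable_bounded_measurable_product_real s) auto
  qed
  obtain M where M: "M > 0" "\<And>x. x \<in> {a<..<b} \<Longrightarrow> \<bar>s x\<bar> \<le> M"
    using s(2) unfolding bounded_pos by auto
  have uc: "uniformly_continuous_on (U \<times> {a..b}) (\<lambda>(t, x). u t x)"
    by (intro compact_uniformly_continuous u compact_Times U) auto
  show "continuous_on U (\<lambda>t. integral {a<..<b} (\<lambda>x. s x * u t x))"
    unfolding continuous_on_iff
  proof (intro ballI allI impI)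
    fix t and e :: real assume t: "t \<in> U" and e: "e > 0"
    \<comment> \<open>The summand 1 keeps the denominator positive even for \<open>a = b\<close> and
      makes the final inequality strict; the absolute value covers an empty interval, since
      \<open>a \<le> b\<close> is not assumed here.\<close>
    define e' where "e' = e / (M * \<bar>b - a\<bar> + 1)"
    have "M * \<bar>b - a\<bar> \<ge> 0" using M by simp
    hence e': "e' > 0" "M * e' * \<bar>b - a\<bar> < e"
      using e by (auto simp: e'_def field_simps)
    obtain d where d: "d > 0"
      "\<And>p q. p \<in> U \<times> {a..b} \<Longrightarrow> q \<in> U \<times> {a..b} \<Longrightarrow> dist q p < d \<Longrightarrow>
         dist (case q of (t, x) \<Rightarrow> u t x) (case p of (t, x) \<Rightarrow> u t x) < e'"
      using uc e' unfolding uniformly_continuous_on_def by metis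
    show "\<exists>d>0. \<forall>t'\<in>U. dist t' t < d \<longrightarrow>
        dist (integral {a<..<b} (\<lambda>x. s x * u t' x)) (integral {a<..<b} (\<lambda>x. s x * u t x)) < e"
    proof (intro exI[of _ d] conjI ballI impI)
      fix t' assume t': "t' \<in> U" "dist t' t < d"
      have int: "(\<lambda>x. s x * u t' x) integrable_on {a<..<b}" "(\<lambda>x. s x * u t x) integrable_on {a<..<b}"
        using ai t t' by (auto simp: absolutely_integrable_on_def)
      have "norm (integral {a<..<b} (\<lambda>x. s x * u t' x - s x * u t x)) \<le> integral {a<..<b} (\<lambda>x. M * e')"
      proof (rule integral_norm_bound_integral)
        show "(\<lambda>x. s x * u t' x - s x * u t x) integrable_on {a<..<b}"
          using int by (rule integrable_diff)
        show "(\<lambda>x. M * e') integrable_on {a<..<b}"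
          unfolding integrable_on_open_interval_real by (rule integrable_const_ivl)
        fix x assume x: "x \<in> {a<..<b}"
        have "\<bar>u t' x - u t x\<bar> \<le> e'"
          using d(2)[of "(t, x)" "(t', x)"] x t t' by (auto simp: dist_Pair_Pair dist_real_def)
        moreover have "norm (s x * u t' x - s x * u t x) = \<bar>s x\<bar> * \<bar>u t' x - u t x\<bar>"
          by (simp add: abs_mult flip: right_diff_distrib)
        ultimately show "norm (s x * u t' x - s x * u t x) \<le> M * e'"
          using M x by (simp add: mult_mono)
      qed
      also have "integral {a<..<b} (\<lambda>x. M * e') = M * e' * max 0 (b - a)"
        by (simp flip: integral_open_interval_real)
      also have "\<dots> \<le> M * e' * \<bar>b - a\<bar>"
        using M e' by (intro mult_left_mono) auto
      also have "\<dots> < e" by fact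
      finally show "dist (integral {a<..<b} (\<lambda>x. s x * u t' x)) (integral {a<..<b} (\<lambda>x. s x * u t x)) < e"
        using int by (simp add: dist_real_def integral_diff)
    qed fact
  qed
qed

text \<open>The integrating factor \<open>exp (- K * s)\<close> turns the differential inequality
  into a bound on the derivative of \<open>exp (- K * s) * E s\<close>, which the fundamental
  theorem integrates over \<open>{0..t}\<close>. Only integrability of \<open>G\<close> enters, and
  one-sided derivatives at the end points suffice.\<close>

lemma gronwall_bound:
  fixes E :: "real \<Rightarrow> real"
  assumes E: "\<And>t. t \<in> {0..T} \<Longrightarrow> (E has_real_derivative E' t) (at t within {0..T})"
    and le: "\<And>t. t \<in> {0..T} \<Longrightarrow> E' t \<le> K * E t + G t"
    and G: "G integrable_on {0..T}" "\<And>t. t \<in> {0..T} \<Longrightarrow> G t \<ge> 0"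
    and K: "K \<ge> 0" and E0: "E 0 \<ge> 0" and t: "t \<in> {0..T}"
  shows "E t \<le> exp (K * T) * (E 0 + integral {0..T} G)"
proof -
  have "((\<lambda>s. exp (- K * s) * (E' s - K * E s)) has_integral exp (- K * t) * E t - exp (- K * 0) * E 0) {0..t}"
  proof (rule fundamental_theorem_of_calculus)
    fix s assume s: "s \<in> {0..t}"
    have "(E has_real_derivative E' s) (at s within {0..t})"
      using s t by (intro has_field_derivative_subset[OF E]) auto
    thus "((\<lambda>s. exp (- K * s) * E s) has_vector_derivative exp (- K * s) * (E' s - K * E s)) (at s within {0..t})"
      unfolding has_real_derivative_iff_has_vector_derivative[symmetric]
      by (auto intro!: derivative_eq_intros simp: algebra_simps)
  qed (use t in auto)
  moreover have "(G has_integral integral {0..t} G) {0..t}"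
    using t by (intro integrable_integral integrable_on_subinterval[OF G(1)]) auto
  ultimately have "exp (- K * t) * E t - exp (- K * 0) * E 0 \<le> integral {0..t} G"
  proof (rule has_integral_le)
    fix s assume s: "s \<in> {0..t}"
    have "exp (- K * s) * (E' s - K * E s) \<le> exp (- K * s) * G s"
      using le[of s] s t by (intro mult_left_mono) auto
    \<comment> \<open>The factor \<open>exp (- K * s)\<close> is at most 1 because \<open>K\<close>
      is nonnegative, and dropping it is safe because \<open>G s\<close> is nonnegative.\<close>
    also have "\<dots> \<le> 1 * G s"
      using G(2)[of s] K s t by (intro mult_right_mono) auto
    finally show "exp (- K * s) * (E' s - K * E s) \<le> G s" by simp
  qed
  also have "\<dots> \<le> integral {0..T} G"
    using t G by (intro integral_subset_le integrable_on_subinterval[OF G(1)]) auto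
  finally have "E t / exp (K * t) \<le> E 0 + integral {0..T} G"
    by (simp add: exp_minus field_simps)
  hence "E t \<le> exp (K * t) * (E 0 + integral {0..T} G)"
    by (simp add: field_simps)
  also have "\<dots> \<le> exp (K * T) * (E 0 + integral {0..T} G)"
    using K t E0 integral_nonneg[OF G] by (intro mult_right_mono) (auto intro: mult_left_mono)
  finally show ?thesis .
qed

section \<open>The energy estimate\<close>

text \<open>\<open>h\<close> plays the role of the error, \<open>ht\<close> and \<open>hx\<close> of its partial derivatives.\<close>

locale energy =
  fixes T a b eps S :: real and \<sigma> :: "real \<Rightarrow> real"
    and h ht hx :: "real \<times> real \<times> real \<Rightarrow> real"
  assumes T: "T > 0" and ab: "a < b" and eps: "eps > 0"
    and sigma_meas: "\<sigma> \<in> borel_measurable (lebesgue_on {a<..<b})"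
    and sigma_bound: "\<And>x. x \<in> {a<..<b} \<Longrightarrow> \<bar>\<sigma> x\<bar> \<le> S"
    and h_cont: "continuous_on ({0..T} \<times> {a..b} \<times> {-1..1}) h"
    and ht_cont: "continuous_on ({0..T} \<times> {a..b} \<times> {-1..1}) ht"
    and hx_cont: "continuous_on ({0..T} \<times> {a..b} \<times> {-1..1}) hx"
    and ht: "\<And>t x v. t \<in> {0..T} \<Longrightarrow> x \<in> {a..b} \<Longrightarrow> v \<in> {-1..1} \<Longrightarrow>
        ((\<lambda>s. h (s, x, v)) has_real_derivative ht (t, x, v)) (at t within {0..T})"
    and hx: "\<And>t x v. t \<in> {0..T} \<Longrightarrow> x \<in> {a..b} \<Longrightarrow> v \<in> {-1..1} \<Longrightarrow>
        ((\<lambda>y. h (t, y, v)) has_real_derivative hx (t, x, v)) (at x within {a..b})"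
begin

definition "mass t x = integral {-1..1} (\<lambda>v. h (t, x, v))"
definition "streaming p = eps * ht p + snd (snd p) * hx p"
text \<open>The factor \<open>\<sigma> x\<close> is left out and the second \<open>1 / eps\<close>
  of the scaling is included, so that \<open>residual\<close> is affine in \<open>\<sigma> x\<close>
  with coefficients continuous on the whole closed domain.\<close>

definition "collision p = (mass (fst p) (fst (snd p)) / 2 - h p) / eps"
definition "residual p = streaming p - \<sigma> (fst (snd p)) * collision p"
definition "energy_density t x = integral {-1..1} (\<lambda>v. (h (t, x, v))\<^sup>2)"
definition "residual_density t x = integral {-1..1} (\<lambda>v. (residual (t, x, v))\<^sup>2)"
definition "total_energy t = integral {a..b} (energy_density t)"
text \<open>The integral runs over the open interval, where \<open>\<sigma>\<close> is controlled;
  the energy itself is continuous up to the end points.\<close>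

definition "total_residual t = integral {a<..<b} (residual_density t)"
text \<open>Incoming velocities are negative at \<open>b\<close> and positive at \<open>a\<close>.
  The flux weight \<open>\<bar>v\<bar>\<close> is absent, as in the boundary loss.\<close>

definition "inflow_energy t = integral {-1..0} (\<lambda>v. (h (t, b, v))\<^sup>2) + integral {0..1} (\<lambda>v. (h (t, a, v))\<^sup>2)"

section \<open>Slices and velocity integrals of continuous functions\<close>

lemma continuous_on_integral_v:
  fixes u :: "real \<times> real \<times> real \<Rightarrow> real"
  assumes "continuous_on ({0..T} \<times> {a..b} \<times> {-1..1}) u"
  shows "continuous_on ({0..T} \<times> {a..b}) (\<lambda>(t, x). integral {-1..1} (\<lambda>v. u (t, x, v)))"
proof -
  have "continuous_on (({0..T} \<times> {a..b}) \<times> cbox (-1) (1::real)) (\<lambda>(p, v). u (fst p, snd p, v))"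
    unfolding split_beta
    by (rule continuous_on_compose2[OF assms]) (auto intro!: continuous_intros)
  from integral_continuous_on_param[OF this] show ?thesis by (simp add: split_beta)
qed

lemma slice_v:
  assumes "continuous_on ({0..T} \<times> {a..b} \<times> {-1..1}) u" "t \<in> {0..T}" "x \<in> {a..b}"
  shows "continuous_on {-1..1} (\<lambda>v. u (t, x, v))"
  by (rule continuous_on_slice[OF continuous_on_slice[OF assms(1,2)] assms(3)])

lemma integrable_v:
  fixes u :: "real \<times> real \<times> real \<Rightarrow> real"
  assumes "continuous_on ({0..T} \<times> {a..b} \<times> {-1..1}) u" "t \<in> {0..T}" "x \<in> {a..b}"
  shows "(\<lambda>v. u (t, x, v)) integrable_on {-1..1}"
  by (intro integrable_continuous_interval slice_v assms)

section \<open>Regularity of the residual\<close>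

lemma streaming_cont: "continuous_on ({0..T} \<times> {a..b} \<times> {-1..1}) streaming"
  unfolding streaming_def by (intro continuous_intros h_cont ht_cont hx_cont)

lemma collision_cont: "continuous_on ({0..T} \<times> {a..b} \<times> {-1..1}) collision"
proof -
  have "continuous_on ({0..T} \<times> {a..b} \<times> {-1..1}) (\<lambda>p. mass (fst p) (fst (snd p)))"
    using continuous_on_compose2[OF continuous_on_integral_v[OF h_cont],
        of "{0..T} \<times> {a..b} \<times> {-1..1}" "\<lambda>p. (fst p, fst (snd p))"]
    by (force simp: mass_def intro!: continuous_intros)
  thus ?thesis
    unfolding collision_def using eps by (intro continuous_intros h_cont) auto
qed

lemma residual_slice:
  assumes "t \<in> {0..T}" "x \<in> {a..b}"
  shows "continuous_on {-1..1} (\<lambda>v. residual (t, x, v))"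
  unfolding residual_def
  by (simp, intro continuous_intros slice_v[OF streaming_cont assms] slice_v[OF collision_cont assms])

text \<open>Expanding the square isolates \<open>\<sigma> x\<close>, which is merely measurable, from integrals that are jointly
  continuous in \<open>(t, x)\<close>.\<close>

lemma residual_density_eq:
  assumes "t \<in> {0..T}" "x \<in> {a..b}"
  shows "residual_density t x = integral {-1..1} (\<lambda>v. (streaming (t, x, v))\<^sup>2)
     - 2 * (\<sigma> x * integral {-1..1} (\<lambda>v. streaming (t, x, v) * collision (t, x, v)))
     + (\<sigma> x)\<^sup>2 * integral {-1..1} (\<lambda>v. (collision (t, x, v))\<^sup>2)"
proof -
  note c = streaming_cont collision_cont
  have i: "(\<lambda>v. (streaming (t, x, v))\<^sup>2) integrable_on {-1..1}"
    "(\<lambda>v. streaming (t, x, v) * collision (t, x, v)) integrable_on {-1..1}"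
    "(\<lambda>v. (collision (t, x, v))\<^sup>2) integrable_on {-1..1}"
    by (intro integrable_continuous_interval continuous_intros slice_v[OF c(1)] slice_v[OF c(2)] assms)+
  have "residual_density t x = integral {-1..1} (\<lambda>v. (streaming (t, x, v))\<^sup>2
     - 2 * (\<sigma> x * (streaming (t, x, v) * collision (t, x, v)))
     + (\<sigma> x)\<^sup>2 * (collision (t, x, v))\<^sup>2)"
    unfolding residual_density_def residual_def
    by (intro arg_cong[where f="integral _"]) (auto simp: power2_eq_square algebra_simps)
  also have "\<dots> = integral {-1..1} (\<lambda>v. (streaming (t, x, v))\<^sup>2)
     - 2 * (\<sigma> x * integral {-1..1} (\<lambda>v. streaming (t, x, v) * collision (t, x, v)))
     + (\<sigma> x)\<^sup>2 * integral {-1..1} (\<lambda>v. (collision (t, x, v))\<^sup>2)"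
    by (intro integral_unique has_integral_add has_integral_diff has_integral_mult_right integrable_integral i)
  finally show ?thesis .
qed

lemma bounded_sigma: "bounded (\<sigma> ` {a<..<b})"
  unfolding bounded_iff using sigma_bound by (intro exI[of _ S]) auto

text \<open>In the expanded form of \<open>residual_density\<close>, three integrals that are
  continuous in \<open>(t, x)\<close> carry the bounded measurable weights 1,
  \<open>\<sigma>\<close> and its square, so \<open>continuous_on_integral_weight\<close> applies to
  each. Continuity in time is what later allows the residual to be integrated over
  \<open>{0..T}\<close>.\<close>

lemma residual_density_integrable:
    "\<And>t. t \<in> {0..T} \<Longrightarrow> residual_density t absolutely_integrable_on {a<..<b}" (is "\<And>t. _ \<Longrightarrow> ?A t")
  and total_residual_cont: "continuous_on {0..T} total_residual"
proof -
  let ?p = "\<lambda>t x. integral {-1..1} (\<lambda>v. (streaming (t, x, v))\<^sup>2)"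
  let ?q = "\<lambda>t x. integral {-1..1} (\<lambda>v. streaming (t, x, v) * collision (t, x, v))"
  let ?r = "\<lambda>t x. integral {-1..1} (\<lambda>v. (collision (t, x, v))\<^sup>2)"
  have p: "continuous_on ({0..T} \<times> {a..b}) (\<lambda>(t, x). ?p t x)"
    by (intro continuous_on_integral_v continuous_intros streaming_cont)
  have q: "continuous_on ({0..T} \<times> {a..b}) (\<lambda>(t, x). ?q t x)"
    by (intro continuous_on_integral_v continuous_intros streaming_cont collision_cont)
  have r: "continuous_on ({0..T} \<times> {a..b}) (\<lambda>(t, x). ?r t x)"
    by (intro continuous_on_integral_v continuous_intros collision_cont)
  have one: "(\<lambda>x. 1 :: real) \<in> borel_measurable (lebesgue_on {a<..<b})" "bounded ((\<lambda>x. 1 :: real) ` {a<..<b})"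
    by (auto simp: bounded_iff)
  have "bounded ((\<lambda>x. (\<sigma> x)\<^sup>2) ` {a<..<b})"
    unfolding bounded_iff using power_mono[OF sigma_bound abs_ge_zero, of _ 2]
    by (intro exI[of _ "S\<^sup>2"]) auto
  note W1 = continuous_on_integral_weight[OF one p compact_Icc, unfolded mult_1_left]
  note W2 = continuous_on_integral_weight[OF sigma_meas bounded_sigma q compact_Icc]
  note W3 = continuous_on_integral_weight[OF borel_measurable_power[OF sigma_meas] \<open>bounded ((\<lambda>x. (\<sigma> x)\<^sup>2) ` {a<..<b})\<close> r compact_Icc]
  show int: "?A t" if t: "t \<in> {0..T}" for t
  proof -
    have "(\<lambda>x. ?p t x - 2 * (\<sigma> x * ?q t x) + (\<sigma> x)\<^sup>2 * ?r t x) absolutely_integrable_on {a<..<b}"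
      by (intro set_integral_add set_integral_diff set_integrable_mult_right)
         (use W1(1) W2(1) W3(1) t in auto)
    also have "?this = ?A t"
      by (rule set_integrable_cong) (use t residual_density_eq in auto)
    finally show ?thesis .
  qed
  have eq: "total_residual t = integral {a<..<b} (?p t) - 2 * integral {a<..<b} (\<lambda>x. \<sigma> x * ?q t x) +
       integral {a<..<b} (\<lambda>x. (\<sigma> x)\<^sup>2 * ?r t x)" if t: "t \<in> {0..T}" for t
  proof -
    have "total_residual t = integral {a<..<b} (\<lambda>x. ?p t x - 2 * (\<sigma> x * ?q t x) + (\<sigma> x)\<^sup>2 * ?r t x)"
      unfolding total_residual_def by (rule integral_cong) (use t residual_density_eq in auto)
    also have "\<dots> = integral {a<..<b} (?p t) - 2 * integral {a<..<b} (\<lambda>x. \<sigma> x * ?q t x) +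
       integral {a<..<b} (\<lambda>x. (\<sigma> x)\<^sup>2 * ?r t x)"
      using W1(1)[OF t] W2(1)[OF t] W3(1)[OF t] unfolding absolutely_integrable_on_def
      by (intro integral_unique has_integral_add has_integral_diff has_integral_mult_right integrable_integral) auto
    finally show ?thesis .
  qed
  show "continuous_on {0..T} total_residual"
  proof (rule continuous_on_eq)
    show "continuous_on {0..T} (\<lambda>t. integral {a<..<b} (?p t) - 2 * integral {a<..<b} (\<lambda>x. \<sigma> x * ?q t x) +
       integral {a<..<b} (\<lambda>x. (\<sigma> x)\<^sup>2 * ?r t x))"
      by (intro continuous_on_add continuous_on_diff continuous_on_mult_left W1(2) W2(2) W3(2))
  qed (simp add: eq)
qed

section \<open>Energy inequality at a fixed position\<close>

lemma mass_square_le: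
  assumes "t \<in> {0..T}" "x \<in> {a..b}"
  shows "(mass t x)\<^sup>2 \<le> 2 * energy_density t x"
proof -
  note c = slice_v[OF h_cont assms]
  have i: "(\<lambda>v. h (t, x, v)) integrable_on {-1..1}" "(\<lambda>v. (h (t, x, v))\<^sup>2) integrable_on {-1..1}"
    by (intro integrable_continuous_interval continuous_intros c)+
  \<comment> \<open>This is Cauchy-Schwarz in disguise: the velocity interval has length 2, so
    \<open>mass t x / 2\<close> is the mean of \<open>h\<close> in \<open>v\<close>, and expanding
    the nonnegative integral of the squared deviation from it gives the claim.\<close>
  have "0 \<le> integral {-1..1} (\<lambda>v. (h (t, x, v) - mass t x / 2)\<^sup>2)"
    by (rule integral_nonneg) (auto intro!: integrable_continuous_interval continuous_intros c)
  also have "(\<lambda>v. (h (t, x, v) - mass t x / 2)\<^sup>2) =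
      (\<lambda>v. (h (t, x, v))\<^sup>2 - mass t x * h (t, x, v) + (mass t x)\<^sup>2 / 4)"
    by (auto simp: power2_eq_square field_simps)
  also have "integral {-1..1} \<dots> = energy_density t x - mass t x * mass t x + (mass t x)\<^sup>2 / 2"
  proof (rule integral_unique)
    have "((\<lambda>v::real. (mass t x)\<^sup>2 / 4) has_integral (mass t x)\<^sup>2 / 2) {-1..1}"
      using has_integral_const_real[of "(mass t x)\<^sup>2 / 4" "-1" 1] by simp
    thus "((\<lambda>v. (h (t, x, v))\<^sup>2 - mass t x * h (t, x, v) + (mass t x)\<^sup>2 / 4) has_integral
        energy_density t x - mass t x * mass t x + (mass t x)\<^sup>2 / 2) {-1..1}"
      using integrable_integral[OF i(1)] integrable_integral[OF i(2)]
      by (intro has_integral_add has_integral_diff has_integral_mult_right) (auto simp: energy_density_def mass_def)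
  qed
  finally show ?thesis by (simp add: power2_eq_square)
qed

text \<open>Multiply \<open>eps * ht = residual - v * hx + \<sigma> x * collision\<close> by
  \<open>2 * h\<close>, estimate \<open>2 * h * residual\<close> by the sum of the two squares, and
  integrate in \<open>v\<close>. The term with \<open>hx\<close> is kept exact, since it becomes a
  boundary flux only after integration in \<open>x\<close>.\<close>

lemma energy_density_derivative_le:
  assumes t: "t \<in> {0..T}" and x: "x \<in> {a<..<b}"
  shows "integral {-1..1} (\<lambda>v. 2 * h (t, x, v) * ht (t, x, v)) \<le>
     (1 + 2 * S / eps) / eps * energy_density t x + residual_density t x / eps
       - integral {-1..1} (\<lambda>v. v * (2 * h (t, x, v) * hx (t, x, v))) / eps"
proof -
  have x': "x \<in> {a..b}" using x by auto
  note c = slice_v[OF h_cont t x'] slice_v[OF ht_cont t x'] slice_v[OF hx_cont t x']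
     slice_v[OF streaming_cont t x'] slice_v[OF collision_cont t x']
  note res = residual_slice[OF t x']
  have i: "(\<lambda>v. h (t, x, v)) integrable_on {-1..1}" "(\<lambda>v. (h (t, x, v))\<^sup>2) integrable_on {-1..1}"
    "(\<lambda>v. (residual (t, x, v))\<^sup>2) integrable_on {-1..1}"
    "(\<lambda>v. v * (2 * h (t, x, v) * hx (t, x, v))) integrable_on {-1..1}"
    by (intro integrable_continuous_interval continuous_intros c res)+
  \<comment> \<open>The coefficient of \<open>h\<close> in
    \<open>2 * h * (\<sigma> x * collision)\<close>; it is constant in \<open>v\<close>, so
    integration turns \<open>k * h\<close> into \<open>k * mass t x\<close>.\<close>
  define k where "k = \<sigma> x / eps * mass t x"
  have "eps * integral {-1..1} (\<lambda>v. 2 * h (t, x, v) * ht (t, x, v)) =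
      integral {-1..1} (\<lambda>v. eps * (2 * h (t, x, v) * ht (t, x, v)))"
    by simp
  also have "\<dots> \<le> integral {-1..1} (\<lambda>v. (h (t, x, v))\<^sup>2 + (residual (t, x, v))\<^sup>2
       - v * (2 * h (t, x, v) * hx (t, x, v)) + k * h (t, x, v) - 2 * \<sigma> x / eps * (h (t, x, v))\<^sup>2)"
  proof (rule integral_le)
    fix v :: real
    have "eps * (2 * h (t, x, v) * ht (t, x, v)) = 2 * h (t, x, v) * residual (t, x, v)
       - v * (2 * h (t, x, v) * hx (t, x, v)) + k * h (t, x, v) - 2 * \<sigma> x / eps * (h (t, x, v))\<^sup>2"
      using eps by (simp add: residual_def streaming_def collision_def k_def field_simps power2_eq_square)
    moreover have "2 * h (t, x, v) * residual (t, x, v) \<le> (h (t, x, v))\<^sup>2 + (residual (t, x, v))\<^sup>2"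
      using sum_squares_bound by blast
    ultimately show "eps * (2 * h (t, x, v) * ht (t, x, v)) \<le> (h (t, x, v))\<^sup>2 + (residual (t, x, v))\<^sup>2
       - v * (2 * h (t, x, v) * hx (t, x, v)) + k * h (t, x, v) - 2 * \<sigma> x / eps * (h (t, x, v))\<^sup>2"
      by linarith
  qed (intro integrable_continuous_interval continuous_intros c res)+
  also have "\<dots> = energy_density t x + residual_density t x
      - integral {-1..1} (\<lambda>v. v * (2 * h (t, x, v) * hx (t, x, v)))
      + k * mass t x - 2 * \<sigma> x / eps * energy_density t x"
    unfolding energy_density_def residual_density_def mass_def
    by (intro integral_unique has_integral_add has_integral_diff has_integral_mult_right integrable_integral i)
  also have "energy_density t x + residual_density t x
      - integral {-1..1} (\<lambda>v. v * (2 * h (t, x, v) * hx (t, x, v)))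
      + k * mass t x - 2 * \<sigma> x / eps * energy_density t x =
      energy_density t x + residual_density t x
      - integral {-1..1} (\<lambda>v. v * (2 * h (t, x, v) * hx (t, x, v))) + \<sigma> x / eps * ((mass t x)\<^sup>2 - 2 * energy_density t x)"
    by (simp add: k_def power2_eq_square algebra_simps)
  \<comment> \<open>The bracket lies between \<open>- 2 * energy_density t x\<close> and 0 by
    \<open>mass_square_le\<close>. As \<open>\<sigma> x\<close> may have either sign, the product is
    estimated by absolute values.\<close>
  also have "\<sigma> x / eps * ((mass t x)\<^sup>2 - 2 * energy_density t x) \<le> 2 * S / eps * energy_density t x"
  proof -
    have m: "(mass t x)\<^sup>2 \<le> 2 * energy_density t x" using mass_square_le t x' by blast
    have "\<sigma> x * ((mass t x)\<^sup>2 - 2 * energy_density t x) \<le> \<bar>\<sigma> x\<bar> * \<bar>(mass t x)\<^sup>2 - 2 * energy_density t x\<bar>"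
      by (metis abs_ge_self abs_mult)
    also have "\<dots> \<le> S * (2 * energy_density t x)"
      using m by (intro mult_mono sigma_bound x) (auto intro: order_trans[OF abs_ge_zero sigma_bound[OF x]])
    finally have "\<sigma> x * ((mass t x)\<^sup>2 - 2 * energy_density t x) / eps \<le> S * (2 * energy_density t x) / eps"
      using eps by (intro divide_right_mono) auto
    thus ?thesis by (simp add: mult_ac)
  qed
  finally have "eps * integral {-1..1} (\<lambda>v. 2 * h (t, x, v) * ht (t, x, v)) \<le> (1 + 2 * S / eps) * energy_density t x + residual_density t x
      - integral {-1..1} (\<lambda>v. v * (2 * h (t, x, v) * hx (t, x, v)))"
    by (simp add: algebra_simps)
  hence "integral {-1..1} (\<lambda>v. 2 * h (t, x, v) * ht (t, x, v)) \<le> ((1 + 2 * S / eps) * energy_density t x + residual_density t x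
      - integral {-1..1} (\<lambda>v. v * (2 * h (t, x, v) * hx (t, x, v)))) / eps"
    using eps by (subst pos_le_divide_eq) (auto simp: mult.commute)
  moreover define C where "C = 1 + 2 * S / eps"
  ultimately show ?thesis unfolding C_def[symmetric]
    by (simp add: diff_divide_distrib add_divide_distrib)
qed

section \<open>Time derivative of the total energy\<close>

lemma energy_density_cont: "continuous_on ({0..T} \<times> {a..b}) (\<lambda>(t, x). energy_density t x)"
  unfolding energy_density_def by (intro continuous_on_integral_v continuous_intros h_cont)

lemma total_energy_cont: "continuous_on {0..T} total_energy"
  unfolding total_energy_def[abs_def]
  using integral_continuous_on_param[of "{0..T}" a b energy_density] energy_density_cont by simp

text \<open>The Leibniz rule is applied twice, first under the integral in \<open>v\<close> and then
  under the one in \<open>x\<close>; joint continuity of \<open>2 * h * ht\<close> on the closed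
  domain justifies both.\<close>

lemma total_energy_derivative:
  assumes t: "t \<in> {0..T}"
  shows "(total_energy has_real_derivative
     integral {a..b} (\<lambda>x. integral {-1..1} (\<lambda>v. 2 * h (t, x, v) * ht (t, x, v)))) (at t within {0..T})"
proof -
  have cont: "continuous_on ({0..T} \<times> {a..b} \<times> {-1..1}) (\<lambda>p. 2 * h p * ht p)"
    by (intro continuous_intros h_cont ht_cont)
  have inner: "((\<lambda>t. energy_density t x) has_real_derivative
       integral {-1..1} (\<lambda>v. 2 * h (t, x, v) * ht (t, x, v))) (at t within {0..T})"
    if t: "t \<in> {0..T}" and x: "x \<in> {a..b}" for t x
    unfolding energy_density_def box_real(2)[symmetric]
  proof (rule leibniz_rule_field_derivative)
    fix s v :: real assume "s \<in> cbox 0 T" "v \<in> cbox (-1) 1"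
    thus "((\<lambda>s. (h (s, x, v))\<^sup>2) has_real_derivative 2 * h (s, x, v) * ht (s, x, v)) (at s within cbox 0 T)"
      using x by (auto intro!: derivative_eq_intros ht)
  next
    fix s assume "s \<in> cbox 0 T"
    thus "(\<lambda>v. (h (s, x, v))\<^sup>2) integrable_on cbox (-1) 1"
      using x by (simp, intro integrable_v[of "\<lambda>p. (h p)\<^sup>2"] continuous_intros h_cont) auto
  next
    show "continuous_on (cbox 0 T \<times> cbox (-1) 1) (\<lambda>(s, v). 2 * h (s, x, v) * ht (s, x, v))"
      unfolding split_beta using x
      by (intro continuous_on_compose2[OF cont, of _ "\<lambda>p. (fst p, x, snd p)"] continuous_intros) auto
  qed (use t in auto)
  show ?thesis
    unfolding total_energy_def[abs_def] box_real(2)[symmetric]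
  proof (rule leibniz_rule_field_derivative)
    fix s x assume "s \<in> cbox 0 T" "x \<in> cbox a b"
    thus "((\<lambda>s. energy_density s x) has_real_derivative
        integral (cbox (-1) 1) (\<lambda>v. 2 * h (s, x, v) * ht (s, x, v))) (at s within cbox 0 T)"
      using inner by simp
  next
    fix s assume "s \<in> cbox 0 T"
    thus "energy_density s integrable_on cbox a b"
      using continuous_on_slice[OF energy_density_cont, of s]
      by (auto intro: integrable_continuous_interval)
  next
    show "continuous_on (cbox 0 T \<times> cbox a b) (\<lambda>(s, x). integral (cbox (-1) 1) (\<lambda>v. 2 * h (s, x, v) * ht (s, x, v)))"
      using continuous_on_integral_v[OF cont] by simp
  qed (use t in auto)
qed

section \<open>Boundary flux\<close>

lemma continuous_on_inflow:
  assumes x: "x \<in> {a..b}" and I: "{c..d} \<subseteq> {-1..1}"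
  shows "continuous_on ({0..T} \<times> {c..d}) (\<lambda>(t, v). (h (t, x, v))\<^sup>2)"
  unfolding split_beta using x I
  by (intro continuous_intros continuous_on_compose2[OF h_cont, of _ "\<lambda>p. (fst p, x, snd p)"]) auto

lemma inflow_energy_cont: "continuous_on {0..T} inflow_energy"
  unfolding inflow_energy_def
  using integral_continuous_on_param[of "{0..T}" "-1" 0 "\<lambda>t v. (h (t, b, v))\<^sup>2"] continuous_on_inflow[of b "-1" 0]
    integral_continuous_on_param[of "{0..T}" 0 1 "\<lambda>t v. (h (t, a, v))\<^sup>2"] continuous_on_inflow[of a 0 1] ab
  by (intro continuous_intros) auto

text \<open>After exchanging the integrals, \<open>v\<close> is a constant factor and
  \<open>2 * h * hx\<close> is the derivative in \<open>x\<close> of the square of \<open>h\<close>,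
  so the inner integral is a difference of boundary values.\<close>

lemma flux_eq:
  assumes t: "t \<in> {0..T}"
  shows "integral {a..b} (\<lambda>x. integral {-1..1} (\<lambda>v. v * (2 * h (t, x, v) * hx (t, x, v)))) =
     integral {-1..1} (\<lambda>v. v * ((h (t, b, v))\<^sup>2 - (h (t, a, v))\<^sup>2))"
proof -
  have cont: "continuous_on ({0..T} \<times> {a..b} \<times> {-1..1}) (\<lambda>p. snd (snd p) * (2 * h p * hx p))"
    by (intro continuous_intros h_cont hx_cont)
  have c: "continuous_on (cbox (a, -1) (b, 1)) (\<lambda>(x, v). v * (2 * h (t, x, v) * hx (t, x, v)))"
    using continuous_on_slice[OF cont t] by (simp add: split_beta cbox_Pair_eq)
  have "integral {-1..1} (\<lambda>v. integral {a..b} (\<lambda>x. v * (2 * h (t, x, v) * hx (t, x, v)))) =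
      integral {-1..1} (\<lambda>v. v * ((h (t, b, v))\<^sup>2 - (h (t, a, v))\<^sup>2))"
  proof (intro integral_cong integral_unique has_integral_mult_right fundamental_theorem_of_calculus)
    fix v x :: real assume "v \<in> {-1..1}" "x \<in> {a..b}"
    thus "((\<lambda>x. (h (t, x, v))\<^sup>2) has_vector_derivative 2 * h (t, x, v) * hx (t, x, v)) (at x within {a..b})"
      unfolding has_real_derivative_iff_has_vector_derivative[symmetric] using t
      by (auto intro!: derivative_eq_intros hx)
  qed (use ab in auto)
  thus ?thesis using integral_swap_continuous[OF c] by simp
qed

text \<open>Splitting at \<open>v = 0\<close> separates the signs. The outgoing parts,
  \<open>v \<ge> 0\<close> at \<open>b\<close> and \<open>v \<le> 0\<close> at \<open>a\<close>,
  contribute nonnegatively and are dropped; on the incoming parts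
  \<open>\<bar>v\<bar> \<le> 1\<close> bounds the loss by the unweighted integral.\<close>

lemma flux_ge:
  assumes t: "t \<in> {0..T}"
  shows "- inflow_energy t \<le> integral {-1..1} (\<lambda>v. v * ((h (t, b, v))\<^sup>2 - (h (t, a, v))\<^sup>2))"
proof -
  have ca: "continuous_on {-1..1} (\<lambda>v. h (t, a, v))" and cb: "continuous_on {-1..1} (\<lambda>v. h (t, b, v))"
    using slice_v[OF h_cont t] ab by auto
  let ?f = "\<lambda>v. v * ((h (t, b, v))\<^sup>2 - (h (t, a, v))\<^sup>2)"
  have f: "?f integrable_on {-1..1}"
    by (intro integrable_continuous_interval continuous_intros ca cb)
  have i: "(\<lambda>v. (h (t, b, v))\<^sup>2) integrable_on {-1..0}" "(\<lambda>v. (h (t, a, v))\<^sup>2) integrable_on {0..1}"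
    by (intro integrable_continuous_interval continuous_intros continuous_on_subset[OF ca] continuous_on_subset[OF cb]; auto)+
  have "integral {-1..1} ?f = integral {-1..0} ?f + integral {0..1} ?f"
    using Henstock_Kurzweil_Integration.integral_combine[OF _ _ f, of 0] by simp
  moreover have "integral {-1..0} (\<lambda>v. - (h (t, b, v))\<^sup>2) \<le> integral {-1..0} ?f"
  proof (rule integral_le)
    fix v :: real assume v: "v \<in> {-1..0}"
    have "v * (h (t, a, v))\<^sup>2 \<le> 0" "-1 * (h (t, b, v))\<^sup>2 \<le> v * (h (t, b, v))\<^sup>2"
      using v by (intro mult_nonpos_nonneg mult_right_mono; simp)+
    thus "- (h (t, b, v))\<^sup>2 \<le> ?f v" by (simp add: algebra_simps)
  qed (use i in \<open>auto intro: integrable_neg integrable_on_subinterval[OF f]\<close>)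
  moreover have "integral {0..1} (\<lambda>v. - (h (t, a, v))\<^sup>2) \<le> integral {0..1} ?f"
  proof (rule integral_le)
    fix v :: real assume v: "v \<in> {0..1}"
    have "0 \<le> v * (h (t, b, v))\<^sup>2" "v * (h (t, a, v))\<^sup>2 \<le> 1 * (h (t, a, v))\<^sup>2"
      using v by (intro mult_nonneg_nonneg mult_right_mono; simp)+
    thus "- (h (t, a, v))\<^sup>2 \<le> ?f v" by (simp add: algebra_simps)
  qed (use i in \<open>auto intro: integrable_neg integrable_on_subinterval[OF f]\<close>)
  ultimately show ?thesis by (simp add: inflow_energy_def)
qed

text \<open>The inequality at fixed \<open>x\<close> holds in the open interval only and is
  integrated there; the energy and flux integrals do not see the end points. The flux enters with a
  minus sign, so \<open>flux_ge\<close> replaces it by the inflow energy.\<close>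

lemma total_energy_derivative_le:
  assumes t: "t \<in> {0..T}"
  shows "integral {a..b} (\<lambda>x. integral {-1..1} (\<lambda>v. 2 * h (t, x, v) * ht (t, x, v))) \<le>
     (1 + 2 * S / eps) / eps * total_energy t + (total_residual t + inflow_energy t) / eps"
proof -
  have cont: "continuous_on ({0..T} \<times> {a..b} \<times> {-1..1}) (\<lambda>p. 2 * h p * ht p)"
     "continuous_on ({0..T} \<times> {a..b} \<times> {-1..1}) (\<lambda>p. snd (snd p) * (2 * h p * hx p))"
    by (intro continuous_intros h_cont ht_cont hx_cont)+
  let ?F = "\<lambda>x. integral {-1..1} (\<lambda>v. v * (2 * h (t, x, v) * hx (t, x, v)))"
  have i: "(\<lambda>x. integral {-1..1} (\<lambda>v. 2 * h (t, x, v) * ht (t, x, v))) integrable_on {a<..<b}"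
     "?F integrable_on {a<..<b}" "energy_density t integrable_on {a<..<b}"
    unfolding integrable_on_open_interval_real
    using continuous_on_slice[OF continuous_on_integral_v[OF cont(1)] t]
      continuous_on_slice[OF continuous_on_integral_v[OF cont(2)] t]
      continuous_on_slice[OF energy_density_cont t]
    by (auto intro!: integrable_continuous_interval)
  have r: "residual_density t integrable_on {a<..<b}"
    using residual_density_integrable[OF t] by (simp add: absolutely_integrable_on_def)
  let ?R = "\<lambda>x. (1 + 2 * S / eps) / eps * energy_density t x + residual_density t x / eps - ?F x / eps"
  have "integral {a<..<b} (\<lambda>x. integral {-1..1} (\<lambda>v. 2 * h (t, x, v) * ht (t, x, v))) \<le> integral {a<..<b} ?R"
    by (intro integral_le i energy_density_derivative_le t integrable_add integrable_diff
      integrable_on_divide r integrable_on_mult_right)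
  also have "integral {a<..<b} ?R =
      (1 + 2 * S / eps) / eps * integral {a<..<b} (energy_density t) + total_residual t / eps - integral {a<..<b} ?F / eps"
    unfolding total_residual_def
    by (intro integral_unique has_integral_add has_integral_diff has_integral_mult_right has_integral_divide integrable_integral i r)
  also have "integral {a<..<b} ?F = integral {-1..1} (\<lambda>v. v * ((h (t, b, v))\<^sup>2 - (h (t, a, v))\<^sup>2))"
    using flux_eq[OF t] by (simp only: integral_open_interval_real)
  also have "(1 + 2 * S / eps) / eps * integral {a<..<b} (energy_density t) + total_residual t / eps - \<dots> / eps \<le>
      (1 + 2 * S / eps) / eps * integral {a<..<b} (energy_density t) + total_residual t / eps - (- inflow_energy t) / eps"
    using eps by (intro diff_left_mono divide_right_mono flux_ge t) auto
  finally show ?thesis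
    by (simp only: integral_open_interval_real total_energy_def add_divide_distrib minus_divide_left[symmetric] diff_minus_eq_add add.assoc)
qed

section \<open>Signs and the Gronwall bound\<close>

lemma energy_density_nonneg: "t \<in> {0..T} \<Longrightarrow> x \<in> {a..b} \<Longrightarrow> 0 \<le> energy_density t x"
  unfolding energy_density_def
  by (intro integral_nonneg integrable_v[of "\<lambda>p. (h p)\<^sup>2"] continuous_intros h_cont) auto

lemma total_energy_nonneg: "t \<in> {0..T} \<Longrightarrow> 0 \<le> total_energy t"
  unfolding total_energy_def
  using continuous_on_slice[OF energy_density_cont, of t]
  by (intro integral_nonneg energy_density_nonneg integrable_continuous_interval) auto

lemma total_residual_nonneg: assumes t: "t \<in> {0..T}" shows "0 \<le> total_residual t"
  unfolding total_residual_def
proof (rule integral_nonneg)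
  show "residual_density t integrable_on {a<..<b}"
    using residual_density_integrable[OF t] by (simp add: absolutely_integrable_on_def)
  fix x assume "x \<in> {a<..<b}"
  hence x: "x \<in> {a..b}" by auto
  show "0 \<le> residual_density t x"
    unfolding residual_density_def
    by (intro integral_nonneg integrable_continuous_interval continuous_intros residual_slice t x) auto
qed

lemma inflow_energy_nonneg: assumes t: "t \<in> {0..T}" shows "0 \<le> inflow_energy t"
proof -
  have "continuous_on {-1..0} (\<lambda>v. (h (t, b, v))\<^sup>2)" "continuous_on {0..1} (\<lambda>v. (h (t, a, v))\<^sup>2)"
    using continuous_on_slice[OF continuous_on_inflow t, of b "-1" 0]
      continuous_on_slice[OF continuous_on_inflow t, of a 0 1] ab by auto
  thus ?thesis
    unfolding inflow_energy_def by (intro add_nonneg_nonneg integral_nonneg integrable_continuous_interval) auto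
qed

text \<open>The midpoint witnesses that the interval is nonempty. The sign makes the Gronwall rate
  nonnegative.\<close>

lemma S_nonneg: "0 \<le> S"
  using sigma_bound[of "(a + b) / 2"] ab by (auto intro: order_trans[OF abs_ge_zero])

theorem total_energy_le:
  assumes t: "t \<in> {0..T}"
  shows "total_energy t \<le> exp ((1 + 2 * S / eps) / eps * T) *
     (total_energy 0 + (integral {0..T} total_residual + integral {0..T} inflow_energy) / eps)"
proof -
  have i: "total_residual integrable_on {0..T}" "inflow_energy integrable_on {0..T}"
    by (intro integrable_continuous_interval total_residual_cont inflow_energy_cont)+
  have "total_energy t \<le> exp ((1 + 2 * S / eps) / eps * T) *
     (total_energy 0 + integral {0..T} (\<lambda>t. (total_residual t + inflow_energy t) / eps))"
  proof (rule gronwall_bound[OF total_energy_derivative total_energy_derivative_le])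
    show "(\<lambda>t. (total_residual t + inflow_energy t) / eps) integrable_on {0..T}"
      by (intro integrable_on_divide integrable_add i)
  qed (use eps S_nonneg total_residual_nonneg inflow_energy_nonneg total_energy_nonneg T t in auto)
  also have "integral {0..T} (\<lambda>t. (total_residual t + inflow_energy t) / eps) =
      (integral {0..T} total_residual + integral {0..T} inflow_energy) / eps"
    by (intro integral_unique has_integral_add has_integral_divide integrable_integral i)
  finally show ?thesis .
qed

end

section \<open>Regularity of network functions\<close>

text \<open>The transport operator differentiates in \<open>t\<close> and \<open>x\<close>, hence
  two partial derivatives. They are explicit arguments, so that closure rules compute them, and
  two-sided on the whole space, so that they restrict to one-sided derivatives on any
  interval.\<close>

definition C1_tx :: "(real \<times> real \<times> real \<Rightarrow> real) \<Rightarrow> (real \<times> real \<times> real \<Rightarrow> real) \<Rightarrow>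
    (real \<times> real \<times> real \<Rightarrow> real) \<Rightarrow> bool" where
  "C1_tx u ut ux \<longleftrightarrow> continuous_on UNIV u \<and> continuous_on UNIV ut \<and> continuous_on UNIV ux \<and>
     (\<forall>t x v. ((\<lambda>s. u (s, x, v)) has_real_derivative ut (t, x, v)) (at t) \<and>
              ((\<lambda>y. u (t, y, v)) has_real_derivative ux (t, x, v)) (at x))"

lemma C1_tx_const: "C1_tx (\<lambda>p. c) (\<lambda>p. 0) (\<lambda>p. 0)"
  by (auto simp: C1_tx_def)

lemma C1_tx_coordinate: "\<exists>ut ux. C1_tx (\<lambda>p. nn_input p i) ut ux"
proof -
  have 1: "C1_tx (\<lambda>p. nn_input p 1) (\<lambda>p. 1) (\<lambda>p. 0)"
    by (auto simp: C1_tx_def nn_input_def split_beta intro!: continuous_intros derivative_eq_intros)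
  have 2: "C1_tx (\<lambda>p. nn_input p 2) (\<lambda>p. 0) (\<lambda>p. 1)"
    by (auto simp: C1_tx_def nn_input_def split_beta intro!: continuous_intros derivative_eq_intros)
  \<comment> \<open>Every index other than 1 and 2 reads the velocity, so no bound on
    \<open>i\<close> is required.\<close>
  have 3: "C1_tx (\<lambda>p. nn_input p i) (\<lambda>p. 0) (\<lambda>p. 0)" if "i \<noteq> 1" "i \<noteq> 2"
    using that
    by (auto simp: C1_tx_def nn_input_def split_beta intro!: continuous_intros derivative_eq_intros)
  from 1 2 3 show ?thesis by (cases "i = 1"; cases "i = 2") blast+
qed

lemma C1_tx_add:
  "C1_tx u ut ux \<Longrightarrow> C1_tx w wt wx \<Longrightarrow> C1_tx (\<lambda>p. u p + w p) (\<lambda>p. ut p + wt p) (\<lambda>p. ux p + wx p)"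
  by (auto simp: C1_tx_def intro!: continuous_intros derivative_intros)

lemma C1_tx_cmult: "C1_tx u ut ux \<Longrightarrow> C1_tx (\<lambda>p. c * u p) (\<lambda>p. c * ut p) (\<lambda>p. c * ux p)"
  by (auto simp: C1_tx_def intro!: continuous_intros derivative_eq_intros)

lemma C1_tx_sum:
  "(\<And>i. i \<in> A \<Longrightarrow> C1_tx (u i) (ut i) (ux i)) \<Longrightarrow>
     C1_tx (\<lambda>p. \<Sum>i\<in>A. u i p) (\<lambda>p. \<Sum>i\<in>A. ut i p) (\<lambda>p. \<Sum>i\<in>A. ux i p)"
  by (induction A rule: infinite_finite_induct) (auto simp: C1_tx_const intro!: C1_tx_add)

lemma C1_tx_compose:
  assumes act: "\<And>z. (act has_real_derivative act' z) (at z)" "continuous_on UNIV act'"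
    and u: "C1_tx u ut ux"
  shows "C1_tx (\<lambda>p. act (u p)) (\<lambda>p. act' (u p) * ut p) (\<lambda>p. act' (u p) * ux p)"
proof -
  have "continuous_on UNIV act"
    using act(1) DERIV_isCont continuous_at_imp_continuous_on by blast
  with u show ?thesis unfolding C1_tx_def
    by (auto intro!: continuous_intros DERIV_chain2[OF act(1)] continuous_on_compose2[OF act(2)]
      continuous_on_compose2[of UNIV act])
qed

text \<open>Induction on the layer, for all units at once since each unit reads the whole layer
  below: a unit is an affine combination of activated units, and \<open>C1_tx\<close> is closed
  under sums, scalar multiples and composition with a \<open>C^1\<close> activation.\<close>

lemma C1_tx_nn_fun:
  assumes act: "act C1_differentiable_on UNIV"
  shows "\<exists>ut ux. C1_tx (nn_fun L act m w \<beta>) ut ux"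
proof -
  obtain act' where act': "\<And>z. (act has_real_derivative act' z) (at z)" "continuous_on UNIV act'"
    using act unfolding C1_differentiable_on_def has_real_derivative_iff_has_vector_derivative by auto
  have "\<exists>ut ux. C1_tx (\<lambda>p. nn_layer act m w \<beta> (nn_input p) l j) ut ux" for l j
  proof (induction l arbitrary: j)
    case 0
    then show ?case using C1_tx_coordinate by simp
  next
    case (Suc l)
    then obtain ut ux where u: "\<And>j. C1_tx (\<lambda>p. nn_layer act m w \<beta> (nn_input p) l j) (ut j) (ux j)"
      by metis
    \<comment> \<open>\<open>y i\<close> is what the next layer reads: the raw input for
      \<open>l = 0\<close>, the activated unit otherwise.\<close>
    define y where "y = (\<lambda>i p. if l = 0 then nn_layer act m w \<beta> (nn_input p) l i
        else act (nn_layer act m w \<beta> (nn_input p) l i))"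
    have "\<exists>zt zx. C1_tx (y i) zt zx" for i
      using u[of i] C1_tx_compose[OF act' u[of i]] unfolding y_def by (cases "l = 0") auto
    then obtain zt zx where z: "\<And>i. C1_tx (y i) (zt i) (zx i)"
      by metis
    have "C1_tx (\<lambda>p. (\<Sum>i = 1..m l. w (Suc l) j i * y i p) + \<beta> (Suc l) j)
        (\<lambda>p. (\<Sum>i = 1..m l. w (Suc l) j i * zt i p) + 0) (\<lambda>p. (\<Sum>i = 1..m l. w (Suc l) j i * zx i p) + 0)"
      by (intro C1_tx_add C1_tx_sum C1_tx_cmult C1_tx_const z)
    thus ?case unfolding nn_layer.simps y_def by (intro exI)
  qed
  thus ?thesis unfolding nn_fun_def[abs_def] .
qed

section \<open>Losses and norms of the error\<close>

lemma set_lebesgue_integral_continuous: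
  fixes u :: "real \<Rightarrow> real"
  assumes "continuous_on {c..d} u"
  shows "(LINT x:{c..d}|lebesgue. u x) = integral {c..d} u"
  by (intro set_lebesgue_integral_eq_integral absolutely_integrable_continuous_real assms)

context energy
begin

text \<open>The product of an open and a closed interval lies between the open and the closed box,
  which differ by a negligible frontier. On the closed box the integrand is continuous, so its
  integral is the iterated one.\<close>

lemma L2_norm_xv_eq:
  assumes t: "t \<in> {0..T}"
  shows "L2_norm_xv a b (\<lambda>(x, v). h (t, x, v)) = sqrt (total_energy t)"
proof -
  let ?g = "\<lambda>(x, v). (h (t, x, v))\<^sup>2"
  have c: "continuous_on (cbox (a, -1) (b, 1)) ?g"
    using continuous_on_slice[OF h_cont t]
    by (simp add: split_beta cbox_Pair_eq continuous_on_power)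
  have sub: "{a<..<b} \<times> {-1..1} \<subseteq> cbox (a, -1::real) (b, 1)" "box (a, -1) (b, 1) \<subseteq> {a<..<b} \<times> {-1..1::real}"
    by (auto simp: cbox_Pair_eq mem_box Basis_prod_def)
  have null: "negligible (cbox (a, -1) (b, 1) - {a<..<b} \<times> {-1..1::real})"
    by (rule negligible_subset[OF negligible_frontier_interval]) (use sub in blast)
  have "set_integrable lebesgue ({a<..<b} \<times> {-1..1}) ?g"
    by (rule set_integrable_subset[OF absolutely_integrable_continuous[OF c]])
       (use sub in \<open>auto intro!: sets_completionI_sets borel_Times\<close>)
  hence "(LINT p:{a<..<b} \<times> {-1..1}|lebesgue. ?g p) = integral ({a<..<b} \<times> {-1..1}) ?g"
    by (rule set_lebesgue_integral_eq_integral)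
  also have "\<dots> = integral (cbox (a, -1) (b, 1)) ?g"
  proof (rule integral_spike_set)
    show "negligible {x \<in> {a<..<b} \<times> {- 1..1} - cbox (a, - 1) (b, 1). ?g x \<noteq> 0}"
      using sub by (auto intro: negligible_subset[OF negligible_empty])
    show "negligible {x \<in> cbox (a, - 1) (b, 1) - {a<..<b} \<times> {- 1..1}. ?g x \<noteq> 0}"
      by (rule negligible_subset[OF null]) auto
  qed
  also have "\<dots> = total_energy t"
    using integral_prod_continuous[OF c] by (simp add: total_energy_def energy_density_def[abs_def])
  finally show ?thesis
    by (simp add: L2_norm_xv_def split_beta)
qed

text \<open>A pointwise bound passes to the essential supremum once measurability in
  \<open>t\<close> is known; on \<open>{0..T}\<close> the norm agrees with the continuous function
  \<open>sqrt (total_energy t)\<close>.\<close>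

lemma Linf_L2_norm_le:
  assumes "\<And>t. t \<in> {0..T} \<Longrightarrow> total_energy t \<le> C"
  shows "0 \<le> Linf_L2_norm T a b h" "Linf_L2_norm T a b h \<le> ereal (sqrt C)"
proof -
  let ?N = "\<lambda>t. ereal (L2_norm_xv a b (\<lambda>(x, v). h (t, x, v)))"
  have "continuous_on {0..T} (\<lambda>t. ereal (sqrt (total_energy t)))"
    by (intro continuous_intros total_energy_cont)
  hence "(\<lambda>t. ereal (sqrt (total_energy t))) \<in> borel_measurable (lebesgue_on {0..T})"
    by (rule continuous_imp_measurable_on_sets_lebesgue) auto
  also have "?this \<longleftrightarrow> ?N \<in> borel_measurable (lebesgue_on {0..T})"
    by (rule measurable_cong) (auto simp: L2_norm_xv_eq)
  finally have meas: "?N \<in> borel_measurable (lebesgue_on {0..T})" .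
  have "AE t in lebesgue_on {0..T}. ?N t \<le> ereal (sqrt C)"
    by (rule AE_I2) (use assms in \<open>auto simp: L2_norm_xv_eq\<close>)
  thus "Linf_L2_norm T a b h \<le> ereal (sqrt C)"
    unfolding Linf_L2_norm_def by (rule esssup_I[OF meas])
  \<comment> \<open>On a space of measure zero the essential supremum of 0 would be minus infinity,
    so nonnegativity rests on \<open>T > 0\<close>.\<close>
  have "emeasure (lebesgue_on {0..T}) (space (lebesgue_on {0..T})) \<noteq> 0"
    using T by (simp add: emeasure_restrict_space)
  hence "0 = esssup (lebesgue_on {0..T}) (\<lambda>t. 0 :: ereal)"
    by (simp add: esssup_const)
  also have "\<dots> \<le> Linf_L2_norm T a b h"
    unfolding Linf_L2_norm_def
    by (rule esssup_AE_mono, simp, rule AE_I2) (auto simp: L2_norm_xv_eq total_energy_nonneg)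
  finally show "0 \<le> Linf_L2_norm T a b h" .
qed

text \<open>Lebesgue and gauge integrals are identified one variable at a time: the integrand is
  continuous in \<open>v\<close>, then absolutely integrable in \<open>x\<close>, then continuous in
  \<open>t\<close>.\<close>

lemma LINT_residual:
  "(LINT t:{0..T}|lebesgue. LINT x:{a<..<b}|lebesgue. LINT v:{-1..1}|lebesgue. (residual (t, x, v))\<^sup>2) =
     integral {0..T} total_residual"
proof -
  have "(LINT t:{0..T}|lebesgue. LINT x:{a<..<b}|lebesgue. LINT v:{-1..1}|lebesgue. (residual (t, x, v))\<^sup>2) =
     (LINT t:{0..T}|lebesgue. LINT x:{a<..<b}|lebesgue. residual_density t x)"
    by (intro set_lebesgue_integral_cong allI impI)
       (auto simp: residual_density_def intro!: set_lebesgue_integral_continuous continuous_on_power residual_slice)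
  also have "\<dots> = (LINT t:{0..T}|lebesgue. total_residual t)"
    by (intro set_lebesgue_integral_cong allI impI)
       (auto simp: total_residual_def intro!: set_lebesgue_integral_eq_integral residual_density_integrable)
  also have "\<dots> = integral {0..T} total_residual"
    by (intro set_lebesgue_integral_continuous total_residual_cont)
  finally show ?thesis .
qed

lemma LINT_energy:
  assumes t: "t \<in> {0..T}"
  shows "(LINT x:{a<..<b}|lebesgue. LINT v:{-1..1}|lebesgue. (h (t, x, v))\<^sup>2) = total_energy t"
proof -
  have "(LINT x:{a<..<b}|lebesgue. LINT v:{-1..1}|lebesgue. (h (t, x, v))\<^sup>2) =
     (LINT x:{a<..<b}|lebesgue. energy_density t x)"
    by (intro set_lebesgue_integral_cong allI impI)
       (use t in \<open>auto simp: energy_density_def intro!: set_lebesgue_integral_continuous continuous_on_power slice_v[OF h_cont]\<close>)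
  also have "\<dots> = integral {a<..<b} (energy_density t)"
  proof (rule set_lebesgue_integral_eq_integral)
    have "energy_density t absolutely_integrable_on {a..b}"
      using continuous_on_slice[OF energy_density_cont t] by (auto intro: absolutely_integrable_continuous_real)
    thus "energy_density t absolutely_integrable_on {a<..<b}"
      by (rule set_integrable_subset) auto
  qed
  finally show ?thesis by (simp only: total_energy_def integral_open_interval_real)
qed

text \<open>The incoming velocities form the half-open intervals \<open>{0<..1}\<close> at
  \<open>a\<close> and \<open>{-1..<0}\<close> at \<open>b\<close>. Adding the point 0 changes no
  integral and gives closed intervals on which the integrand is continuous.\<close>

lemma LINT_inflow:
  "(\<Sum>x\<in>{a, b}. LINT t:{0..T}|lebesgue. LINT v:{v \<in> {-1..1}. outward_normal a b x * v < 0}|lebesgue. (h (t, x, v))\<^sup>2) =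
     integral {0..T} inflow_energy"
proof -
  have half_open: "(LINT v:I|lebesgue. u v) = integral {c..d} u"
    if "continuous_on {c..d} u" "I \<in> sets lebesgue" "{c<..<d} \<subseteq> I" "I \<subseteq> {c..d}"
    for u :: "real \<Rightarrow> real" and I and c d :: real
  proof -
    have "(LINT v:I|lebesgue. u v) = integral I u"
      by (rule set_lebesgue_integral_eq_integral, rule set_integrable_subset[OF absolutely_integrable_continuous_real[OF that(1)]])
         (use that in auto)
    also have "\<dots> = integral {c..d} u"
    proof (rule integral_spike_set)
      show "negligible {x \<in> I - {c..d}. u x \<noteq> 0}"
        by (rule negligible_subset[OF negligible_empty]) (use that in auto)
      show "negligible {x \<in> {c..d} - I. u x \<noteq> 0}"
        by (rule negligible_subset[of "{c, d}"]) (use that in force)+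
    qed
    finally show ?thesis .
  qed
  have ca: "continuous_on {0..1} (\<lambda>v. (h (t, a, v))\<^sup>2)" and cb: "continuous_on {-1..0} (\<lambda>v. (h (t, b, v))\<^sup>2)"
    if "t \<in> {0..T}" for t
    using continuous_on_slice[OF continuous_on_inflow that, of b "-1" 0]
      continuous_on_slice[OF continuous_on_inflow that, of a 0 1] ab by auto
  have Ia: "{v \<in> {-1..1}. outward_normal a b a * v < 0} = {0<..1}"
    and Ib: "{v \<in> {-1..1}. outward_normal a b b * v < 0} = {-1..<0}"
    using ab by (auto simp: outward_normal_def)
  have "(LINT t:{0..T}|lebesgue. LINT v:{v \<in> {-1..1}. outward_normal a b a * v < 0}|lebesgue. (h (t, a, v))\<^sup>2) =
      (LINT t:{0..T}|lebesgue. integral {0..1} (\<lambda>v. (h (t, a, v))\<^sup>2))"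
    unfolding Ia by (intro set_lebesgue_integral_cong allI impI half_open ca) auto
  also have "\<dots> = integral {0..T} (\<lambda>t. integral {0..1} (\<lambda>v. (h (t, a, v))\<^sup>2))"
    using integral_continuous_on_param[of "{0..T}" 0 1 "\<lambda>t v. (h (t, a, v))\<^sup>2"] continuous_on_inflow[of a 0 1] ab
    by (intro set_lebesgue_integral_continuous) auto
  finally have A: "(LINT t:{0..T}|lebesgue. LINT v:{v \<in> {-1..1}. outward_normal a b a * v < 0}|lebesgue. (h (t, a, v))\<^sup>2) =
      integral {0..T} (\<lambda>t. integral {0..1} (\<lambda>v. (h (t, a, v))\<^sup>2))" .
  have "(LINT t:{0..T}|lebesgue. LINT v:{v \<in> {-1..1}. outward_normal a b b * v < 0}|lebesgue. (h (t, b, v))\<^sup>2) =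
      (LINT t:{0..T}|lebesgue. integral {-1..0} (\<lambda>v. (h (t, b, v))\<^sup>2))"
    unfolding Ib by (intro set_lebesgue_integral_cong allI impI half_open cb) auto
  also have "\<dots> = integral {0..T} (\<lambda>t. integral {-1..0} (\<lambda>v. (h (t, b, v))\<^sup>2))"
    using integral_continuous_on_param[of "{0..T}" "-1" 0 "\<lambda>t v. (h (t, b, v))\<^sup>2"] continuous_on_inflow[of b "-1" 0] ab
    by (intro set_lebesgue_integral_continuous) auto
  finally have B: "(LINT t:{0..T}|lebesgue. LINT v:{v \<in> {-1..1}. outward_normal a b b * v < 0}|lebesgue. (h (t, b, v))\<^sup>2) =
      integral {0..T} (\<lambda>t. integral {-1..0} (\<lambda>v. (h (t, b, v))\<^sup>2))" .
  have "(\<lambda>t. integral {0..1} (\<lambda>v. (h (t, a, v))\<^sup>2)) integrable_on {0..T}"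
    "(\<lambda>t. integral {-1..0} (\<lambda>v. (h (t, b, v))\<^sup>2)) integrable_on {0..T}"
    using integral_continuous_on_param[of "{0..T}" "-1" 0 "\<lambda>t v. (h (t, b, v))\<^sup>2"] continuous_on_inflow[of b "-1" 0] ab
      integral_continuous_on_param[of "{0..T}" 0 1 "\<lambda>t v. (h (t, a, v))\<^sup>2"] continuous_on_inflow[of a 0 1]
    by (auto intro!: integrable_continuous_interval)
  thus ?thesis using ab unfolding inflow_energy_def[abs_def] by (simp add: A[simplified] B[simplified] integral_add)
qed

end

section \<open>Comparison of an approximation with the solution\<close>

lemma C1_up_to_boundaryD:
  assumes "C1_up_to_boundary T a b f"
  defines "D \<equiv> {0..T} \<times> {a..b} \<times> {-1..1}"
  shows "continuous_on D f" "continuous_on D (partial_t T f)" "continuous_on D (partial_x a b f)"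
    and "\<And>t x v. (t, x, v) \<in> D \<Longrightarrow>
      ((\<lambda>s. f (s, x, v)) has_real_derivative partial_t T f (t, x, v)) (at t within {0..T})"
    and "\<And>t x v. (t, x, v) \<in> D \<Longrightarrow>
      ((\<lambda>y. f (t, y, v)) has_real_derivative partial_x a b f (t, x, v)) (at x within {a..b})"
proof -
  show "continuous_on D f" "continuous_on D (partial_t T f)" "continuous_on D (partial_x a b f)"
    using assms(1) by (simp_all add: C1_up_to_boundary_def Let_def D_def)
  fix t x v assume "(t, x, v) \<in> D"
  \<comment> \<open>Differentiability ensures that the value selected by
    \<open>vector_derivative\<close> really is a derivative.\<close>
  hence "(\<lambda>s. f (s, x, v)) differentiable (at t within {0..T})"
    "(\<lambda>y. f (t, y, v)) differentiable (at x within {a..b})"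
    using assms(1) unfolding C1_up_to_boundary_def Let_def D_def by blast+
  thus "((\<lambda>s. f (s, x, v)) has_real_derivative partial_t T f (t, x, v)) (at t within {0..T})"
    "((\<lambda>y. f (t, y, v)) has_real_derivative partial_x a b f (t, x, v)) (at x within {a..b})"
    unfolding has_real_derivative_iff_has_vector_derivative partial_t_def partial_x_def split_conv
    by (simp_all flip: vector_derivative_works)
qed

text \<open>A derivative within an interval is unique only if the interval is nondegenerate, whence
  \<open>T > 0\<close> and \<open>a < b\<close>.\<close>

lemma partial_eq_C1_tx:
  assumes "C1_tx u ut ux"
  shows "T > 0 \<Longrightarrow> t \<in> {0..T} \<Longrightarrow> partial_t T u (t, x, v) = ut (t, x, v)"
    and "a < b \<Longrightarrow> x \<in> {a..b} \<Longrightarrow> partial_x a b u (t, x, v) = ux (t, x, v)"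
proof -
  have "((\<lambda>s. u (s, x, v)) has_vector_derivative ut (t, x, v)) (at t within A)"
    "((\<lambda>y. u (t, y, v)) has_vector_derivative ux (t, x, v)) (at x within A)" for A
    using assms unfolding C1_tx_def has_real_derivative_iff_has_vector_derivative
    by (blast intro: has_vector_derivative_at_within)+
  thus "T > 0 \<Longrightarrow> t \<in> {0..T} \<Longrightarrow> partial_t T u (t, x, v) = ut (t, x, v)"
    "a < b \<Longrightarrow> x \<in> {a..b} \<Longrightarrow> partial_x a b u (t, x, v) = ux (t, x, v)"
    unfolding partial_t_def partial_x_def split_conv
    by (blast intro: vector_derivative_within_closed_interval)+
qed

text \<open>Since \<open>f\<close> solves the problem exactly, the three losses of \<open>u\<close> are the squared norms of the
  residual, the initial value and the inflow value of the error \<open>u - f\<close>.\<close>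

lemma Linf_L2_error_le:
  fixes T \<epsilon> a b S :: real
  assumes T: "T > 0" and \<epsilon>: "\<epsilon> > 0" and ab: "a < b"
    and sigma: "\<sigma> \<in> borel_measurable (lebesgue_on {a<..<b})" "\<And>x. x \<in> {a<..<b} \<Longrightarrow> \<bar>\<sigma> x\<bar> \<le> S"
    and f_C1: "C1_up_to_boundary T a b f"
    and transport: "\<And>t x v. t \<in> {0..T} \<Longrightarrow> x \<in> {a<..<b} \<Longrightarrow> v \<in> {-1..1} \<Longrightarrow>
          \<epsilon> * partial_t T f (t, x, v) + v * partial_x a b f (t, x, v)
            = 1 / \<epsilon> * scattering \<sigma> f (t, x, v)"
    and initial: "\<And>x v. x \<in> {a<..<b} \<Longrightarrow> v \<in> {-1..1} \<Longrightarrow> f (0, x, v) = f0 (x, v)"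
    and inflow: "\<And>t x v. t \<in> {0..T} \<Longrightarrow> (x, v) \<in> gamma_minus a b \<Longrightarrow> f (t, x, v) = g (t, x, v)"
    and u: "C1_tx u ut ux"
  defines "GE \<equiv> Loss_GE T a b \<epsilon> \<sigma> u" and "IC \<equiv> Loss_IC a b f0 u" and "BC \<equiv> Loss_BC T a b g u"
  shows "0 \<le> GE" "0 \<le> IC" "0 \<le> BC"
    and "0 \<le> Linf_L2_norm T a b (\<lambda>p. u p - f p)"
    and "Linf_L2_norm T a b (\<lambda>p. u p - f p) \<le>
      ereal (sqrt (exp ((1 + 2 * S / \<epsilon>) / \<epsilon> * T) * (IC + (GE + BC) / \<epsilon>)))"
proof -
  let ?h = "\<lambda>p. u p - f p" and ?ht = "\<lambda>p. ut p - partial_t T f p" and ?hx = "\<lambda>p. ux p - partial_x a b f p"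
  note f = C1_up_to_boundaryD[OF f_C1]
  have uc: "continuous_on A u" "continuous_on A ut" "continuous_on A ux" for A
    using u continuous_on_subset[of UNIV] by (auto simp: C1_tx_def)
  have ud: "((\<lambda>s. u (s, x, v)) has_real_derivative ut (t, x, v)) (at t within A)"
    "((\<lambda>y. u (t, y, v)) has_real_derivative ux (t, x, v)) (at x within A)" for t x v A
    using u by (auto simp: C1_tx_def intro: has_field_derivative_at_within)
  interpret energy T a b \<epsilon> S \<sigma> ?h ?ht ?hx
    by unfold_locales (use T \<epsilon> ab sigma in \<open>auto intro!: continuous_intros derivative_intros f uc ud\<close>)
  \<comment> \<open>The transport operator is linear, and by \<open>transport\<close> its value at
    \<open>f\<close> vanishes for \<open>x\<close> in the open interval, so the residual of the
    error is that of \<open>u\<close>.\<close>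
  have res: "\<epsilon> * partial_t T u (t, x, v) + v * partial_x a b u (t, x, v) - 1 / \<epsilon> * scattering \<sigma> u (t, x, v) =
      residual (t, x, v)" if t: "t \<in> {0..T}" and x: "x \<in> {a<..<b}" and v: "v \<in> {-1..1}" for t x v
  proof -
    have x': "x \<in> {a..b}" using x by auto
    have "continuous_on {-1..1} (\<lambda>v. u (t, x, v))" "continuous_on {-1..1} (\<lambda>v. f (t, x, v))"
      using slice_v[OF uc(1) t x'] slice_v[OF f(1) t x'] by auto
    hence s: "scattering \<sigma> u (t, x, v) = \<sigma> x * (1 / 2 * integral {-1..1} (\<lambda>v. u (t, x, v)) - u (t, x, v))"
      "scattering \<sigma> f (t, x, v) = \<sigma> x * (1 / 2 * integral {-1..1} (\<lambda>v. f (t, x, v)) - f (t, x, v))"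
      "mass t x = integral {-1..1} (\<lambda>v. u (t, x, v)) - integral {-1..1} (\<lambda>v. f (t, x, v))"
      by (auto simp: scattering_def mass_def set_lebesgue_integral_continuous
          intro!: integral_diff integrable_continuous_interval)
    have "residual (t, x, v) = \<epsilon> * ut (t, x, v) + v * ux (t, x, v) - 1 / \<epsilon> * scattering \<sigma> u (t, x, v)
       - (\<epsilon> * partial_t T f (t, x, v) + v * partial_x a b f (t, x, v) - 1 / \<epsilon> * scattering \<sigma> f (t, x, v))"
      unfolding residual_def streaming_def collision_def fst_conv snd_conv s using \<epsilon> by (simp add: field_simps)
    thus ?thesis
      using transport[OF t x v] partial_eq_C1_tx(1)[OF u T t, of x v] partial_eq_C1_tx(2)[OF u ab x', of t v]
      by simp
  qed
  have GE: "GE = integral {0..T} total_residual"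
    unfolding GE_def Loss_GE_def LINT_residual[symmetric]
  proof (intro set_lebesgue_integral_cong allI impI)
    fix t x v :: real assume "t \<in> {0..T}" "x \<in> {a<..<b}" "v \<in> {-1..1}"
    from res[OF this]
    show "\<bar>\<epsilon> * partial_t T u (t, x, v) + v * partial_x a b u (t, x, v) - 1 / \<epsilon> * scattering \<sigma> u (t, x, v)\<bar>\<^sup>2 =
        (residual (t, x, v))\<^sup>2"
      by (simp only: power2_abs)
  qed auto
  have IC: "IC = total_energy 0"
  proof -
    have "IC = (LINT x:{a<..<b}|lebesgue. LINT v:{-1..1}|lebesgue. (?h (0, x, v))\<^sup>2)"
      unfolding IC_def Loss_IC_def
      by (intro set_lebesgue_integral_cong allI impI) (auto simp: initial)
    thus ?thesis using LINT_energy[of 0] T by simp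
  qed
  have BC: "BC = integral {0..T} inflow_energy"
    unfolding BC_def Loss_BC_def LINT_inflow[symmetric]
  proof (intro sum.cong set_lebesgue_integral_cong allI impI refl)
    fix x t v assume "x \<in> {a, b}" "t \<in> {0..T}" "v \<in> {v \<in> {-1..1}. outward_normal a b x * v < 0}"
    thus "\<bar>u (t, x, v) - g (t, x, v)\<bar>\<^sup>2 = (?h (t, x, v))\<^sup>2"
      using inflow[of t x v] by (auto simp: gamma_minus_def)
  next
    fix x
    \<comment> \<open>Replacing the integrand also requires the set of incoming velocities to be
      measurable; it is a closed interval intersected with an open set.\<close>
    have "{v \<in> {-1..1}. outward_normal a b x * v < 0} = {-1..1} \<inter> {v. outward_normal a b x * v < 0}" by auto
    also have "\<dots> \<in> sets borel"
      by (rule sets.Int, simp, intro borel_open open_Collect_less continuous_intros)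
    finally show "{v \<in> {-1..1}. outward_normal a b x * v < 0} \<in> sets lebesgue"
      by (intro sets_completionI_sets) simp
  qed auto
  show "0 \<le> IC" using T by (simp add: IC total_energy_nonneg)
  show "0 \<le> GE" unfolding GE
    by (intro integral_nonneg integrable_continuous_interval total_residual_cont total_residual_nonneg)
  show "0 \<le> BC" unfolding BC
    by (intro integral_nonneg integrable_continuous_interval inflow_energy_cont inflow_energy_nonneg)
  show "0 \<le> Linf_L2_norm T a b ?h"
    by (rule Linf_L2_norm_le(1)[OF total_energy_le])
  show "Linf_L2_norm T a b ?h \<le>
      ereal (sqrt (exp ((1 + 2 * S / \<epsilon>) / \<epsilon> * T) * (IC + (GE + BC) / \<epsilon>)))"
    unfolding IC GE BC by (rule Linf_L2_norm_le(2)[OF total_energy_le])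
qed

theorem theorem4p2:
  fixes T \<epsilon> a b lam_g lam_i lam_b :: real
    and \<sigma> act :: "real \<Rightarrow> real"
    and f0 :: "real \<times> real \<Rightarrow> real"
    and f g :: "real \<times> real \<times> real \<Rightarrow> real"
    and L :: nat
    and m :: "nat \<Rightarrow> nat \<Rightarrow> nat"
    and w :: "nat \<Rightarrow> nat \<Rightarrow> nat \<Rightarrow> nat \<Rightarrow> real"
    and \<beta> :: "nat \<Rightarrow> nat \<Rightarrow> nat \<Rightarrow> real"
  assumes "T > 0" and "\<epsilon> > 0" and "a < b"
    and "lam_g > 0" and "lam_i > 0" and "lam_b > 0"
    and sigma_measurable: "\<sigma> \<in> borel_measurable (lebesgue_on {a<..<b})"
    and sigma_bounded: "bounded (\<sigma> ` {a<..<b})"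
    and f_C1: "C1_up_to_boundary T a b f"
    and transport: "\<And>t x v. t \<in> {0..T} \<Longrightarrow> x \<in> {a<..<b} \<Longrightarrow> v \<in> {-1..1} \<Longrightarrow>
          \<epsilon> * partial_t T f (t, x, v) + v * partial_x a b f (t, x, v)
            = 1 / \<epsilon> * scattering \<sigma> f (t, x, v)"
    and initial: "\<And>x v. x \<in> {a<..<b} \<Longrightarrow> v \<in> {-1..1} \<Longrightarrow> f (0, x, v) = f0 (x, v)"
    and inflow: "\<And>t x v. t \<in> {0..T} \<Longrightarrow> (x, v) \<in> gamma_minus a b \<Longrightarrow> f (t, x, v) = g (t, x, v)"
    and layers: "L \<ge> 2"
    and act_C1: "act C1_differentiable_on UNIV"
    and input_width: "\<And>j. m j 0 = 3"
    and loss: "(\<lambda>j. Loss_Total lam_g lam_i lam_b T a b \<epsilon> \<sigma> f0 g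
                   (nn_fun L act (m j) (w j) (\<beta> j))) \<longlonglongrightarrow> 0"
  shows "(\<lambda>j. Linf_L2_norm T a b
            (\<lambda>p. nn_fun L act (m j) (w j) (\<beta> j) p - f p)) \<longlonglongrightarrow> 0"
proof -
  obtain S where S: "\<And>x. x \<in> {a<..<b} \<Longrightarrow> \<bar>\<sigma> x\<bar> \<le> S"
    using sigma_bounded unfolding bounded_iff by (auto simp del: greaterThanLessThan_iff)
  define u where "u j = nn_fun L act (m j) (w j) (\<beta> j)" for j
  define Q where "Q = exp ((1 + 2 * S / \<epsilon>) / \<epsilon> * T)"
  \<comment> \<open>All three losses are nonnegative, so each is at most the total loss divided by
    its own weight; \<open>C\<close> collects these reciprocals with the factors of the energy
    bound.\<close>
  define C where "C = Q * (1 / lam_i + (1 / lam_g + 1 / lam_b) / \<epsilon>)"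
  define tot where "tot j = Loss_Total lam_g lam_i lam_b T a b \<epsilon> \<sigma> f0 g (u j)" for j
  have bounds: "0 \<le> Linf_L2_norm T a b (\<lambda>p. u j p - f p)"
    "Linf_L2_norm T a b (\<lambda>p. u j p - f p) \<le> ereal (sqrt (C * tot j))" for j
  proof -
    obtain ut ux where "C1_tx (u j) ut ux"
      using C1_tx_nn_fun[OF act_C1] unfolding u_def by blast
    note E = Linf_L2_error_le[OF \<open>T > 0\<close> \<open>\<epsilon> > 0\<close> \<open>a < b\<close> sigma_measurable S f_C1 transport initial inflow this]
    show "0 \<le> Linf_L2_norm T a b (\<lambda>p. u j p - f p)" by (rule E(4))
    define GE IC BC where "GE = Loss_GE T a b \<epsilon> \<sigma> (u j)"
      and "IC = Loss_IC a b f0 (u j)" and "BC = Loss_BC T a b g (u j)"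
    have nn: "0 \<le> GE" "0 \<le> IC" "0 \<le> BC" using E(1-3) by (auto simp: GE_def IC_def BC_def)
    have "0 \<le> lam_g * GE" "0 \<le> lam_i * IC" "0 \<le> lam_b * BC"
      using nn assms(4-6) by simp_all
    moreover have "tot j = lam_g * GE + lam_i * IC + lam_b * BC"
      by (simp add: tot_def Loss_Total_def GE_def IC_def BC_def)
    ultimately have "lam_g * GE \<le> tot j" "lam_i * IC \<le> tot j" "lam_b * BC \<le> tot j" by linarith+
    hence "GE \<le> 1 / lam_g * tot j" "IC \<le> 1 / lam_i * tot j" "BC \<le> 1 / lam_b * tot j"
      using assms(4-6) by (simp_all add: field_simps)
    hence "Q * (IC + (GE + BC) / \<epsilon>) \<le> Q * (1 / lam_i * tot j + (1 / lam_g * tot j + 1 / lam_b * tot j) / \<epsilon>)"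
      using \<open>\<epsilon> > 0\<close> by (intro mult_left_mono add_mono divide_right_mono) (auto simp: Q_def)
    also have "\<dots> = C * tot j"
      by (simp add: C_def algebra_simps add_divide_distrib)
    finally have "ereal (sqrt (Q * (IC + (GE + BC) / \<epsilon>))) \<le> ereal (sqrt (C * tot j))" by simp
    with E(5) show "Linf_L2_norm T a b (\<lambda>p. u j p - f p) \<le> ereal (sqrt (C * tot j))"
      unfolding Q_def GE_def IC_def BC_def by (rule order_trans)
  qed
  have "tot \<longlonglongrightarrow> 0" using loss unfolding tot_def[abs_def] u_def .
  hence "(\<lambda>j. sqrt (C * tot j)) \<longlonglongrightarrow> sqrt (C * 0)"
    by (intro tendsto_intros)
  hence "(\<lambda>j. ereal (sqrt (C * tot j))) \<longlonglongrightarrow> 0"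
    by (simp add: zero_ereal_def)
  \<comment> \<open>The norm is squeezed between 0 and a multiple of the square root of the total
    loss.\<close>
  hence "(\<lambda>j. Linf_L2_norm T a b (\<lambda>p. u j p - f p)) \<longlonglongrightarrow> 0"
    by (rule tendsto_sandwich[OF _ _ tendsto_const, rotated 2]) (simp_all add: bounds)
  thus ?thesis unfolding u_def .
qed

end
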